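(* Let $\succ$ and $\succ_0$ be $0$-compatible preference relations over the same relation schema such that one of them is an interval order (IO) and the other is a strict partial order (SPO). Then for each $\theta\in\{\cup,\triangleright,\otimes\}$ the preference relation $TC(\succ_0\,\theta\,\succ)$ is an SPO. Moreover, if the IO is a weak order (WO), then $TC(\succ_0\,\theta\,\succ)=(\succ_0\,\theta\,\succ)$.
   Context: A relation schema $R(A_1,\dots,A_k)$ assigns each attribute $A_i$ a domain $U_i$, either a countably infinite set $D$ of uninterpreted constants or the set $\mathbb{Q}$ of rational numbers; tuples are elements of $U=U_1\times\cdots\times U_k$. A preference relation over $R$ is any subset of $U\times U$ (possibly infinite). A preference relation $\succ$ is: an SPO if it is irreflexive and transitive; an IO if it is an SPO and for all $x,y,z,w$, $(x\succ y\wedge z\succ w)$ implies $(x\succ w\vee z\succ y)$; a WO if it is an SPO and negatively transitive: $(x\not\succ y\wedge y\not\succ z)$ implies $x\not\succ z$. Composition operators for preference relations over the same schema: union $\succ_1\cup\succ_2$ is set union; prioritized composition: $t_1(\succ_1\triangleright\succ_2)t_2$ iff $t_1\succ_1 t_2\vee(t_2\not\succ_1 t_1\wedge t_1\succ_2 t_2)$; Pareto composition: $t_1(\succ_1\otimes\succ_2)t_2$ iff $(t_1\succ_1 t_2\wedge t_2\not\succ_2 t_1)\vee(t_1\succ_2 t_2\wedge t_2\not\succ_1 t_1)$. $TC(\cdot)$ denotes transitive closure (chains of length $\ge 1$). A $0$-conflict between $\succ$ and $\succ_0$ is a pair $(t_1,t_2)$ with $t_1\succ_0 t_2$ and $t_2\succ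 t_1$. The relations are $0$-compatible if there are no $0$-conflicts between them (a symmetric notion). *)

theory Defs
  imports Main "HOL-Library.Countable_Set"
begin

datatype 'd val = Const 'd | Num rat

datatype attr_domain = DomD | DomQ

text \<open>A relation schema is given by the list of the domains of its attributes
  \<open>A\<^sub>1, \<dots>, A\<^sub>k\<close>; attribute names play no role.\<close>
type_synonym schema = "attr_domain list"

fun domain_set :: "'d set \<Rightarrow> attr_domain \<Rightarrow> 'd val set" where
  "domain_set D DomD = Const ` D"
| "domain_set D DomQ = range Num"

text \<open>\<open>listset [U\<^sub>1, \<dots>, U\<^sub>k]\<close> is the product \<open>U\<^sub>1 \<times> \<dots> \<times> U\<^sub>k\<close>, with tuples encoded as lists.\<close>
definition tuples :: "'d set \<Rightarrow> schema \<Rightarrow> 'd val list set" where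
  "tuples D R = listset (map (domain_set D) R)"

text \<open>Below, \<open>(t\<^sub>1, t\<^sub>2) \<in> r\<close> stands for \<open>t\<^sub>1 \<succ> t\<^sub>2\<close>.\<close>

definition preference_relation :: "'a set \<Rightarrow> 'a rel \<Rightarrow> bool" where
  "preference_relation U r \<longleftrightarrow> r \<subseteq> U \<times> U"

definition spo :: "'a set \<Rightarrow> 'a rel \<Rightarrow> bool" where
  "spo U r \<longleftrightarrow> preference_relation U r \<and> irrefl_on U r \<and> trans_on U r"

definition interval_order :: "'a set \<Rightarrow> 'a rel \<Rightarrow> bool" where
  "interval_order U r \<longleftrightarrow> spo U r \<and>
     (\<forall>x\<in>U. \<forall>y\<in>U. \<forall>z\<in>U. \<forall>w\<in>U. (x, y) \<in> r \<and> (z, w) \<in> r \<longrightarrow> (x, w) \<in> r \<or> (z, y) \<in> r)"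

text \<open>The restriction of the quantifiers to \<open>U\<close> is essential for negative transitivity: an element
  of the type outside \<open>U\<close> is unrelated to everything and would force \<open>r\<close> to be empty.\<close>
definition weak_order :: "'a set \<Rightarrow> 'a rel \<Rightarrow> bool" where
  "weak_order U r \<longleftrightarrow> spo U r \<and>
     (\<forall>x\<in>U. \<forall>y\<in>U. \<forall>z\<in>U. (x, y) \<notin> r \<and> (y, z) \<notin> r \<longrightarrow> (x, z) \<notin> r)"

definition prioritized :: "'a rel \<Rightarrow> 'a rel \<Rightarrow> 'a rel" where
  "prioritized r\<^sub>1 r\<^sub>2 =
     {(t\<^sub>1, t\<^sub>2). (t\<^sub>1, t\<^sub>2) \<in> r\<^sub>1 \<or> ((t\<^sub>2, t\<^sub>1) \<notin> r\<^sub>1 \<and> (t\<^sub>1, t\<^sub>2) \<in> r\<^sub>2)}"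

definition pareto :: "'a rel \<Rightarrow> 'a rel \<Rightarrow> 'a rel" where
  "pareto r\<^sub>1 r\<^sub>2 =
     {(t\<^sub>1, t\<^sub>2). ((t\<^sub>1, t\<^sub>2) \<in> r\<^sub>1 \<and> (t\<^sub>2, t\<^sub>1) \<notin> r\<^sub>2) \<or> ((t\<^sub>1, t\<^sub>2) \<in> r\<^sub>2 \<and> (t\<^sub>2, t\<^sub>1) \<notin> r\<^sub>1)}"

definition zero_conflicts :: "'a rel \<Rightarrow> 'a rel \<Rightarrow> 'a rel" where
  "zero_conflicts r r\<^sub>0 = {(t\<^sub>1, t\<^sub>2). (t\<^sub>1, t\<^sub>2) \<in> r\<^sub>0 \<and> (t\<^sub>2, t\<^sub>1) \<in> r}"

definition zero_compatible :: "'a rel \<Rightarrow> 'a rel \<Rightarrow> bool" where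
  "zero_compatible r r\<^sub>0 \<longleftrightarrow> zero_conflicts r r\<^sub>0 = {}"

end

(* By 0-compatibility all three compositions are the union of the interval order I and the SPO S.
   If a I b, b S c or b = c, and c I d, then the interval order condition gives a I d, the
   alternative c I b being a 0-conflict. Hence a path in I \<union> S collapses to a path with
   at most one I-step, and a cycle of that shape would be a 0-conflict. *)
theory Submission
  imports Defs
begin

lemma zero_compatible_sym: "zero_compatible r s \<longleftrightarrow> zero_compatible s r"
  by (auto simp: zero_compatible_def zero_conflicts_def)

text \<open>The negated side condition can fail only at a 0-conflict.\<close>

lemma prioritized_eq_union: "zero_compatible r s \<Longrightarrow> prioritized s r = s \<union> r"
  by (auto simp: zero_compatible_def zero_conflicts_def prioritized_def)

lemma pareto_eq_union: "zero_compatible r s \<Longrightarrow> pareto s r = s \<union> r"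
  by (auto simp: zero_compatible_def zero_conflicts_def pareto_def)

lemma spo_subset: "spo U r \<Longrightarrow> r \<subseteq> U \<times> U"
  by (simp add: spo_def preference_relation_def)

text \<open>Since \<open>r\<close> lies in \<open>U \<times> U\<close>, irreflexivity on
  \<open>U\<close> extends to the whole type.\<close>

lemma spo_irrefl: "spo U r \<Longrightarrow> (x, x) \<notin> r"
  by (auto simp: spo_def preference_relation_def irrefl_on_def)

lemma spo_trans: "spo U r \<Longrightarrow> trans r"
  by (rule transI) (auto simp: spo_def preference_relation_def dest: trans_onD)

lemma interval_order_absorb:
  assumes io: "interval_order U I" and comp: "zero_compatible I S"
  shows "I O S\<^sup>= O I \<subseteq> I"
proof clarify
  fix a b c d
  assume ab: "(a, b) \<in> I" and bc: "(b, c) \<in> S\<^sup>=" and cd: "(c, d) \<in> I"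
  have I: "spo U I" using io by (simp add: interval_order_def)
  show "(a, d) \<in> I"
  proof (cases "b = c")
    case True
    with ab cd show ?thesis using transD[OF spo_trans[OF I]] by blast
  next
    case False
    with bc have "(c, b) \<notin> I"
      using comp by (auto simp: zero_compatible_def zero_conflicts_def)
    with ab cd spo_subset[OF I] show ?thesis
      using io unfolding interval_order_def by blast
  qed
qed

lemma spo_trancl_union:
  assumes io: "interval_order U I" and sp: "spo U S" and comp: "zero_compatible I S"
  shows "spo U ((I \<union> S)\<^sup>+)"
proof -
  \<comment> \<open>The paths with no I-step or exactly one, their S-steps merged by transitivity.
    \<open>S\<^sup>=\<close> allows an empty S-part beside the I-step; the first part is
    \<open>S\<close> itself, since \<open>S\<^sup>=\<close> would put the diagonal into
    \<open>K\<close>.\<close>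
  define K where "K = S \<union> S\<^sup>= O I O S\<^sup>="
  have I: "spo U I" using io by (simp add: interval_order_def)
  have tS: "(x, z) \<in> S\<^sup>=" if "(x, y) \<in> S\<^sup>=" "(y, z) \<in> S\<^sup>=" for x y z
    using that transD[OF spo_trans[OF sp]] by blast
  have "trans K"
  proof (rule transI)
    fix x y z assume "(x, y) \<in> K" "(y, z) \<in> K"
    \<comment> \<open>The cases count the I-steps: none, one after \<open>y\<close>, one before
      \<open>y\<close>, one on each side.\<close>
    then consider
        "(x, y) \<in> S" "(y, z) \<in> S"
      | b c where "(x, y) \<in> S\<^sup>=" "(y, b) \<in> S\<^sup>=" "(b, c) \<in> I" "(c, z) \<in> S\<^sup>="
      | b c where "(x, b) \<in> S\<^sup>=" "(b, c) \<in> I" "(c, y) \<in> S\<^sup>=" "(y, z) \<in> S\<^sup>="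
      | a b c d where "(x, a) \<in> S\<^sup>=" "(a, b) \<in> I" "(b, y) \<in> S\<^sup>="
          "(y, c) \<in> S\<^sup>=" "(c, d) \<in> I" "(d, z) \<in> S\<^sup>="
      unfolding K_def by blast
    then show "(x, z) \<in> K"
    proof cases
      case 1
      then show ?thesis using transD[OF spo_trans[OF sp]] unfolding K_def by blast
    next
      case (2 b c)
      then show ?thesis using tS[of x y b] unfolding K_def by blast
    next
      case (3 b c)
      then show ?thesis using tS[of c y z] unfolding K_def by blast
    next
      case (4 a b c d)
      \<comment> \<open>The two S-parts meeting at \<open>y\<close> merge into one between the
        I-steps, and the whole stretch is absorbed into a single I-step.\<close>
      then have "(a, d) \<in> I"
        using tS[of b y c] interval_order_absorb[OF io comp] by blast
      with 4 show ?thesis unfolding K_def by blast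
    qed
  qed
  moreover have "I \<union> S \<subseteq> K" unfolding K_def by auto
  ultimately have TK: "(I \<union> S)\<^sup>+ \<subseteq> K"
    by (metis trancl_id trancl_mono_subset)
  have "(x, x) \<notin> K" for x
  proof
    assume "(x, x) \<in> K"
    then obtain b c where "(x, b) \<in> S\<^sup>=" "(b, c) \<in> I" "(c, x) \<in> S\<^sup>="
      using spo_irrefl[OF sp] unfolding K_def by blast
    \<comment> \<open>Rotating the cycle through \<open>x\<close> leads from \<open>c\<close> back
      to \<open>b\<close> in \<open>S\<^sup>=\<close>: equality contradicts irreflexivity of
      \<open>I\<close>, and an S-step is a 0-conflict with \<open>(b, c)\<close>.\<close>
    with tS[of c x b] show False
      using comp spo_irrefl[OF I] by (auto simp: zero_compatible_def zero_conflicts_def)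
  qed
  with TK have "irrefl_on U ((I \<union> S)\<^sup>+)" by (auto simp: irrefl_on_def)
  moreover have "(I \<union> S)\<^sup>+ \<subseteq> U \<times> U"
    by (rule trancl_subset_Sigma) (use spo_subset[OF I] spo_subset[OF sp] in blast)
  ultimately show ?thesis
    by (auto simp: spo_def preference_relation_def intro: trans_onI)
qed

text \<open>Two mixed steps always compose to a W-step: negative transitivity compares the W-step
  with the third point, and one of the two outcomes reverses the S-step, which is a
  0-conflict.\<close>

lemma trans_union_weak_order:
  assumes wo: "weak_order U W" and sp: "spo U S" and comp: "zero_compatible W S"
  shows "trans (W \<union> S)"
proof (rule transI)
  fix x y z assume xy: "(x, y) \<in> W \<union> S" and yz: "(y, z) \<in> W \<union> S"
  have W: "spo U W" using wo by (simp add: weak_order_def)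
  have U: "x \<in> U" "y \<in> U" "z \<in> U"
    using xy yz spo_subset[OF W] spo_subset[OF sp] by auto
  have neg: "(a, c) \<in> W \<or> (c, b) \<in> W" if "(a, b) \<in> W" "a \<in> U" "b \<in> U" "c \<in> U" for a b c
    using wo that unfolding weak_order_def by blast
  have conflict: "(b, a) \<notin> W" if "(a, b) \<in> S" for a b
    using comp that by (auto simp: zero_compatible_def zero_conflicts_def)
  show "(x, z) \<in> W \<union> S"
    \<comment> \<open>The first instance of \<open>neg\<close> serves W followed by S, the second S
      followed by W.\<close>
    using xy yz neg[of x y z] neg[of y z x] U conflict
      transD[OF spo_trans[OF W], of x y z] transD[OF spo_trans[OF sp], of x y z] by blast
qed

theorem theorem1:
  fixes D :: "'d set" and R :: schema and r r\<^sub>0 :: "'d val list rel"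
  assumes "countable D" and "infinite D"
    and "preference_relation (tuples D R) r"
    and "preference_relation (tuples D R) r\<^sub>0"
    and "zero_compatible r r\<^sub>0"
    and "(interval_order (tuples D R) r \<and> spo (tuples D R) r\<^sub>0) \<or>
         (interval_order (tuples D R) r\<^sub>0 \<and> spo (tuples D R) r)"
  shows "\<forall>\<theta>\<in>{(\<union>), prioritized, pareto}.
           spo (tuples D R) ((\<theta> r\<^sub>0 r)\<^sup>+) \<and>
           ((interval_order (tuples D R) r \<and> spo (tuples D R) r\<^sub>0 \<and> weak_order (tuples D R) r) \<or>
            (interval_order (tuples D R) r\<^sub>0 \<and> spo (tuples D R) r \<and> weak_order (tuples D R) r\<^sub>0)
            \<longrightarrow> (\<theta> r\<^sub>0 r)\<^sup>+ = \<theta> r\<^sub>0 r)"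
proof -
  let ?U = "tuples D R"
  have comp: "zero_compatible r r\<^sub>0" "zero_compatible r\<^sub>0 r"
    using assms(5) zero_compatible_sym by blast+
  \<comment> \<open>Either relation may be the interval order; commuting the union reduces both
    cases to the same lemma.\<close>
  have "spo ?U ((r\<^sub>0 \<union> r)\<^sup>+)"
    using assms(6) spo_trancl_union comp by (metis Un_commute)
  moreover have "(r\<^sub>0 \<union> r)\<^sup>+ = r\<^sub>0 \<union> r"
    if "(spo ?U r\<^sub>0 \<and> weak_order ?U r) \<or> (spo ?U r \<and> weak_order ?U r\<^sub>0)"
    using that trans_union_weak_order comp by (metis Un_commute trancl_id)
  ultimately show ?thesis
    using prioritized_eq_union[OF comp(1)] pareto_eq_union[OF comp(1)] by auto
qed

end
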